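(* Let $K/F$ be a field extension, let $\mathbf{x}=x_1,\dots,x_n$ be a sequence of $n\ge 1$ variables, let $R=F[\![\mathbf{x}]\!]$ and $S=K[\![\mathbf{x}]\!]$, with $S$ regarded as an $R$-module via the inclusion $R\subseteq S$. Then: (a) if $S$ is a free $R$-module, then it has finite rank over $R$; (b) $S$ is a free $R$-module if and only if $K$ is a finite extension of $F$ (i.e. $[K:F]<\infty$).
   Context: $F[\![\mathbf{x}]\!]$ and $K[\![\mathbf{x}]\!]$ denote the formal power series rings in the commuting variables $x_1,\dots,x_n$ over $F$ and $K$. The inclusion $F[\![\mathbf{x}]\!]\subseteq K[\![\mathbf{x}]\!]$ is the one induced coefficientwise by the field extension $F\subseteq K$. *)

theory Defs
  imports Complex_Main "HOL-Library.Function_Algebras" "HOL-Library.FuncSet"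
begin

section \<open>Formal power series in finitely many commuting variables\<close>

text \<open>
  The variables are indexed by a finite type \<open>'n\<close>, so their number is
  \<open>CARD('n) \<ge> 1\<close>. The monomial with exponent vector \<open>m\<close> is represented by
  \<open>m :: 'n \<Rightarrow> nat\<close>; multiplying monomials is the pointwise addition of
  \<^theory>\<open>HOL-Library.Function_Algebras\<close>.
\<close>

typedef (overloaded) ('a, 'n) mfps = "UNIV :: (('n::finite \<Rightarrow> nat) \<Rightarrow> 'a::zero) set"
  morphisms mfps_nth Abs_mfps
  by simp

setup_lifting type_definition_mfps

lemma mfps_eqI: "(\<And>m. mfps_nth f m = mfps_nth g m) \<Longrightarrow> f = g"
  by transfer auto

definition splits :: "('n \<Rightarrow> nat) \<Rightarrow> (('n \<Rightarrow> nat) \<times> ('n \<Rightarrow> nat)) set"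
  where "splits m = {(p, q). p + q = m}"

lemma finite_splits [simp]: "finite (splits (m :: 'n::finite \<Rightarrow> nat))"
proof -
  have fin: "finite {p :: 'n \<Rightarrow> nat. p \<le> m}"
  proof (rule finite_subset)
    show "{p. p \<le> m} \<subseteq> Pi\<^sub>E UNIV (\<lambda>i. {..m i})"
      by (auto simp: le_fun_def)
    show "finite (Pi\<^sub>E UNIV (\<lambda>i. {..m i}))"
      by (rule finite_PiE) auto
  qed
  have "splits m \<subseteq> {p. p \<le> m} \<times> {p. p \<le> m}"
    by (auto simp: splits_def le_fun_def)
  then show ?thesis
    using fin finite_subset by blast
qed

instantiation mfps :: (comm_ring_1, finite) comm_ring_1
begin

lift_definition zero_mfps :: "('a, 'b) mfps" is "\<lambda>_. 0" .

lift_definition one_mfps :: "('a, 'b) mfps" is "\<lambda>m. if m = 0 then 1 else 0" .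

lift_definition plus_mfps :: "('a, 'b) mfps \<Rightarrow> ('a, 'b) mfps \<Rightarrow> ('a, 'b) mfps"
  is "\<lambda>f g m. f m + g m" .

lift_definition minus_mfps :: "('a, 'b) mfps \<Rightarrow> ('a, 'b) mfps \<Rightarrow> ('a, 'b) mfps"
  is "\<lambda>f g m. f m - g m" .

lift_definition uminus_mfps :: "('a, 'b) mfps \<Rightarrow> ('a, 'b) mfps"
  is "\<lambda>f m. - f m" .

lift_definition times_mfps :: "('a, 'b) mfps \<Rightarrow> ('a, 'b) mfps \<Rightarrow> ('a, 'b) mfps"
  is "\<lambda>f g m. \<Sum>(p, q)\<in>splits m. f p * g q" .

instance
proof
  fix f g h :: "('a, 'b) mfps"
  show "f * g * h = f * (g * h)"
  proof transfer
    fix f g h :: "('b \<Rightarrow> nat) \<Rightarrow> 'a"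
    have "(\<Sum>(p, q)\<in>splits m. (\<Sum>(a, b)\<in>splits p. f a * g b) * h q)
        = (\<Sum>(p, q)\<in>splits m. f p * (\<Sum>(a, b)\<in>splits q. g a * h b))" (is "?L = ?R") for m
    proof -
      have "?L = (\<Sum>x\<in>splits m. \<Sum>y\<in>splits (fst x). f (fst y) * g (snd y) * h (snd x))"
        by (simp add: sum_distrib_right case_prod_unfold)
      also have "\<dots> = (\<Sum>(x, y)\<in>Sigma (splits m) (\<lambda>x. splits (fst x)).
                       f (fst y) * g (snd y) * h (snd x))"
        by (rule sum.Sigma) auto
      also have "\<dots> = (\<Sum>(x, y)\<in>Sigma (splits m) (\<lambda>x. splits (snd x)).
                       f (fst x) * g (fst y) * h (snd y))"
        by (rule sum.reindex_bij_witness[where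
              i = "\<lambda>((p, q), (a, b)). ((p + a, b), (p, a))" and
              j = "\<lambda>((p, q), (a, b)). ((a, b + q), (b, q))"])
           (auto simp: splits_def add.assoc)
      also have "\<dots> = (\<Sum>x\<in>splits m. \<Sum>y\<in>splits (snd x). f (fst x) * g (fst y) * h (snd y))"
        by (rule sum.Sigma [symmetric]) auto
      also have "\<dots> = ?R"
        by (simp add: sum_distrib_left case_prod_unfold mult.assoc)
      finally show ?thesis .
    qed
    then show "(\<lambda>m. \<Sum>(p, q)\<in>splits m. (\<Sum>(p, q)\<in>splits p. f p * g q) * h q) =
               (\<lambda>m. \<Sum>(p, q)\<in>splits m. f p * (\<Sum>(p, q)\<in>splits q. g p * h q))"
      by blast
  qed
  show "f * g = g * f"
  proof transfer
    fix f g :: "('b \<Rightarrow> nat) \<Rightarrow> 'a"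
    have "(\<Sum>(p, q)\<in>splits m. f p * g q) = (\<Sum>(p, q)\<in>splits m. g p * f q)" for m
      by (rule sum.reindex_bij_witness[where i = prod.swap and j = prod.swap])
         (auto simp: splits_def add.commute mult.commute)
    then show "(\<lambda>m. \<Sum>(p, q)\<in>splits m. f p * g q) = (\<lambda>m. \<Sum>(p, q)\<in>splits m. g p * f q)"
      by blast
  qed
  show "1 * f = f"
  proof transfer
    fix f :: "('b \<Rightarrow> nat) \<Rightarrow> 'a"
    have "(\<Sum>(p, q)\<in>splits m. (if p = 0 then 1 else 0) * f q) = f m" for m
    proof -
      have "(\<Sum>(p, q)\<in>splits m. (if p = 0 then 1 else 0) * f q)
          = (\<Sum>(p, q)\<in>{(0 :: 'b \<Rightarrow> nat, m)}. (if p = 0 then 1 else 0) * f q)"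
        by (rule sum.mono_neutral_right) (simp, auto simp: splits_def split: if_splits)
      then show ?thesis by simp
    qed
    then show "(\<lambda>m. \<Sum>(p, q)\<in>splits m. (if p = 0 then 1 else 0) * f q) = f"
      by blast
  qed
  show "(f + g) * h = f * h + g * h"
    by transfer (simp add: distrib_right case_prod_unfold sum.distrib)
  show "(0 :: ('a, 'b) mfps) \<noteq> 1"
    by transfer (metis zero_neq_one)
qed (transfer; simp add: algebra_simps)+

end


section \<open>Field extensions and the induced module structure\<close>

locale field_extension =
  fixes \<iota> :: "'f::field \<Rightarrow> 'k::field"
  assumes hom_add: "\<iota> (a + b) = \<iota> a + \<iota> b"
    and hom_mult: "\<iota> (a * b) = \<iota> a * \<iota> b"
    and hom_one: "\<iota> 1 = 1"
begin

lemma hom_zero: "\<iota> 0 = 0"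
  using hom_add[of 0 0] by (metis add_0 add_cancel_right_right)

lemma hom_sum: "\<iota> (sum g A) = (\<Sum>x\<in>A. \<iota> (g x))"
  by (induction A rule: infinite_finite_induct) (simp_all add: hom_zero hom_add)

lemma inj_hom: "inj \<iota>"
proof (rule injI)
  fix a b assume eq: "\<iota> a = \<iota> b"
  have "\<iota> (a - b) = 0"
    using hom_add[of "a - b" b] eq by simp
  moreover have "\<iota> (a - b) \<noteq> 0" if "a \<noteq> b"
    using hom_mult[of "a - b" "inverse (a - b)"] that by (auto simp: hom_one)
  ultimately show "a = b" by blast
qed

end

definition finite_extension :: "('f::field \<Rightarrow> 'k::field) \<Rightarrow> bool"
  where "finite_extension \<iota> \<longleftrightarrow> (\<exists>B. finite_dimensional_vector_space (\<lambda>a x. \<iota> a * x) B)"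

lift_definition mfps_map :: "('a::zero \<Rightarrow> 'b::zero) \<Rightarrow> ('a, 'n::finite) mfps \<Rightarrow> ('b, 'n) mfps"
  is "\<lambda>h f m. h (f m)" .

definition mfps_scale ::
    "('f::field \<Rightarrow> 'k::field) \<Rightarrow> ('f, 'n::finite) mfps \<Rightarrow> ('k, 'n) mfps \<Rightarrow> ('k, 'n) mfps"
  where "mfps_scale \<iota> r s = mfps_map \<iota> r * s"

lemma mfps_nth_map [simp]: "mfps_nth (mfps_map h f) m = h (mfps_nth f m)"
  by transfer simp

lemma (in field_extension) inj_mfps_map:
  "inj (mfps_map \<iota> :: ('f, 'n::finite) mfps \<Rightarrow> ('k, 'n) mfps)"
proof (rule injI)
  fix f g :: "('f, 'n) mfps"
  assume "mfps_map \<iota> f = mfps_map \<iota> g"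
  then show "f = g"
    using inj_hom by transfer (auto simp: fun_eq_iff inj_def)
qed

lemma (in field_extension) mfps_map_add: "mfps_map \<iota> (f + g) = mfps_map \<iota> f + mfps_map \<iota> g"
  by (rule mfps_eqI) (simp add: plus_mfps.rep_eq hom_add)

lemma (in field_extension) mfps_map_mult: "mfps_map \<iota> (f * g) = mfps_map \<iota> f * mfps_map \<iota> g"
  by (rule mfps_eqI) (simp add: times_mfps.rep_eq hom_sum hom_mult case_prod_unfold)

lemma (in field_extension) mfps_map_one: "mfps_map \<iota> 1 = 1"
  by (rule mfps_eqI) (simp add: one_mfps.rep_eq hom_zero hom_one)

lemma (in field_extension) module_mfps_scale:
  "module (mfps_scale \<iota> :: ('f, 'n::finite) mfps \<Rightarrow> ('k, 'n) mfps \<Rightarrow> ('k, 'n) mfps)"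
  by standard
     (simp_all add: mfps_scale_def mfps_map_add mfps_map_mult mfps_map_one algebra_simps)


section \<open>Free modules\<close>

definition module_basis :: "('r::comm_ring_1 \<Rightarrow> 'm::ab_group_add \<Rightarrow> 'm) \<Rightarrow> 'm set \<Rightarrow> bool"
  where "module_basis scale B \<longleftrightarrow> module.independent scale B \<and> module.span scale B = UNIV"

definition free_module :: "('r::comm_ring_1 \<Rightarrow> 'm::ab_group_add \<Rightarrow> 'm) \<Rightarrow> bool"
  where "free_module scale \<longleftrightarrow> (\<exists>B. module_basis scale B)"

text \<open>
  Over a nonzero commutative ring all bases of a free module have the same
  cardinality, so a free module has finite rank iff some basis is finite.
\<close>

definition free_module_of_finite_rank :: "('r::comm_ring_1 \<Rightarrow> 'm::ab_group_add \<Rightarrow> 'm) \<Rightarrow> bool"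
  where "free_module_of_finite_rank scale \<longleftrightarrow> (\<exists>B. finite B \<and> module_basis scale B)"

end

theory Submission
  imports Defs
begin

text \<open>
  A basis of \<open>K[[x]]\<close> over \<open>F[[x]]\<close> must be finite: for distinct basis elements
  \<open>b\<^sub>0, b\<^sub>1, \<dots>\<close> and a variable \<open>X\<close>, the convergent series \<open>\<Sum>i. X\<^sup>i b\<^sub>i\<close> would have a
  nonzero coordinate at every \<open>b\<^sub>i\<close>, because modulo \<open>X\<^sup>i\<^sup>+\<^sup>1\<close> this coordinate is \<open>X\<^sup>i\<close>.
  Given a finite basis, reducing modulo the variables shows that its constant terms span
  \<open>K\<close> over \<open>F\<close>. Conversely, a finite basis of \<open>K\<close> over \<open>F\<close>, read as constant series, is a
  basis of \<open>K[[x]]\<close>, since linear combinations can be formed coefficientwise.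
\<close>

text \<open>
  The equations \<open>s\<^sub>n = b\<^sub>n + x s\<^sub>n\<^sub>+\<^sub>1\<close> say that \<open>s\<^sub>n\<close> is a value of the infinite sum
  \<open>\<Sum>i. x\<^sup>i b\<^sub>n\<^sub>+\<^sub>i\<close>; no topology is needed.
\<close>

lemma (in module) finite_basis_if_geometric_sums:
  assumes indep: "independent B" and span: "span B = UNIV"
    and cancel: "\<And>r. x * r = 0 \<Longrightarrow> r = 0"
    and nonunit: "\<And>r. 1 + x * r \<noteq> 0"
    and sums: "\<And>b :: nat \<Rightarrow> 'b. \<exists>s. \<forall>n. s n = b n + x *s s (Suc n)"
  shows "finite B"
proof (rule ccontr)
  assume "infinite B"
  then obtain b :: "nat \<Rightarrow> 'b" where inj: "inj b" and b: "range b \<subseteq> B"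
    using infinite_countable_subset by blast
  obtain s where s: "\<And>n. s n = b n + x *s s (Suc n)"
    using sums[of b] by blast
  \<comment> \<open>Coordinates are linear because \<open>B\<close> is a basis, so the recurrence
    for \<open>s\<close> passes to each coordinate.\<close>
  have rep: "representation B (s n) c = (if c = b n then 1 else 0) + x * representation B (s (Suc n)) c"
    for n c
  proof -
    have "b n \<in> B" using b by blast
    then show ?thesis
      by (subst s) (simp add: representation_add representation_scale representation_basis indep span)
  qed
  \<comment> \<open>If the coordinate at \<open>b i\<close> vanishes for \<open>s 0\<close>,
    cancelling \<open>x\<close> carries this on to \<open>s i\<close>, as \<open>b i\<close> differs
    from every earlier \<open>b n\<close>. At \<open>n = i\<close> the recurrence then reads
    \<open>0 = 1 + x * r\<close>.\<close>
  have "representation B (s 0) (b i) \<noteq> 0" for i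
  proof
    assume 0: "representation B (s 0) (b i) = 0"
    have "n \<le> i \<Longrightarrow> representation B (s n) (b i) = 0" for n
    proof (induction n)
      case (Suc n)
      then have "b i \<noteq> b n" using inj by (auto dest: injD)
      with Suc rep[of n "b i"] show ?case by (auto intro: cancel)
    qed (use 0 in simp)
    then have "1 + x * representation B (s (Suc i)) (b i) = 0"
      using rep[of i "b i"] by simp
    with nonunit show False by blast
  qed
  then have "range b \<subseteq> {c. representation B (s 0) c \<noteq> 0}" by blast
  then have "finite (range b)"
    using finite_representation finite_subset by blast
  with inj show False using finite_imageD by blast
qed

section \<open>Coefficients of sums and products, constant series\<close>

lemma mfps_nth_sum: "mfps_nth (\<Sum>i\<in>A. f i) m = (\<Sum>i\<in>A. mfps_nth (f i) m)"
  by (induction A rule: infinite_finite_induct) (simp_all add: zero_mfps.rep_eq plus_mfps.rep_eq)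

text \<open>The exponent 0 splits only as 0 + 0. Taking constant terms is thus multiplicative: it is
  the reduction modulo the variables.\<close>

lemma mfps_nth_mult_zero: "mfps_nth (f * g) 0 = mfps_nth f 0 * mfps_nth g 0"
proof -
  have "splits (0 :: 'b \<Rightarrow> nat) = {(0, 0)}"
    by (auto simp: splits_def fun_eq_iff)
  then show ?thesis by (simp add: times_mfps.rep_eq)
qed

definition mfps_const :: "'a::zero \<Rightarrow> ('a, 'n::finite) mfps"
  where "mfps_const a = Abs_mfps (\<lambda>m. if m = 0 then a else 0)"

lemma mfps_nth_const: "mfps_nth (mfps_const a) m = (if m = 0 then a else 0)"
  by (simp add: mfps_const_def Abs_mfps_inverse)

lemma inj_mfps_const: "inj mfps_const"
  by (rule injI) (metis mfps_nth_const)

text \<open>Only the split \<open>(m, 0)\<close> contributes. This lets combinations of constant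
  series be handled one exponent at a time.\<close>

lemma mfps_nth_mult_const:
  fixes f :: "('a::comm_ring_1, 'n::finite) mfps"
  shows "mfps_nth (f * mfps_const a) m = mfps_nth f m * a"
proof -
  let ?a = "mfps_const a :: ('a, 'n) mfps"
  have "(\<Sum>(p, q)\<in>splits m. mfps_nth f p * mfps_nth ?a q)
      = (\<Sum>(p, q)\<in>{(m, 0)}. mfps_nth f p * mfps_nth ?a q)"
    by (rule sum.mono_neutral_right)
       (simp, auto simp: splits_def mfps_nth_const split: if_splits)
  then show ?thesis by (simp add: times_mfps.rep_eq mfps_nth_const)
qed

section \<open>Multiplication by a variable\<close>

definition mfps_var :: "'n \<Rightarrow> ('a::zero_neq_one, 'n::finite) mfps"
  where "mfps_var v = Abs_mfps (\<lambda>m. if m = 0(v := 1) then 1 else 0)"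

lemma mfps_nth_var: "mfps_nth (mfps_var v) m = (if m = 0(v := 1) then 1 else 0)"
  by (simp add: mfps_var_def Abs_mfps_inverse)

text \<open>Only a split whose first part is the unit vector at \<open>v\<close> contributes, and
  one exists just when \<open>m v\<close> is positive.\<close>

lemma mfps_nth_var_mult:
  fixes f :: "('a::comm_ring_1, 'n::finite) mfps"
  shows "mfps_nth (mfps_var v * f) m = (if m v = 0 then 0 else mfps_nth f (m(v := m v - 1)))"
proof (cases "m v = 0")
  case True
  then have "(\<Sum>(p, q)\<in>splits m. mfps_nth (mfps_var v) p * mfps_nth f q) = 0"
    by (intro sum.neutral) (auto simp: splits_def mfps_nth_var)
  with True show ?thesis by (simp add: times_mfps.rep_eq)
next
  case False
  then have split: "0(v := 1) + m(v := m v - 1) = m"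
    by (auto simp: fun_eq_iff)
  let ?X = "mfps_var v :: ('a, 'n) mfps"
  have "mfps_nth ?X p * mfps_nth f q = 0"
    if "p + q = m" and "(p, q) \<noteq> (0(v := 1), m(v := m v - 1))" for p q
  proof -
    have "q = m(v := m v - 1)" if "p = 0(v := 1)"
      using \<open>p + q = m\<close> that by auto
    with that(2) show ?thesis by (auto simp: mfps_nth_var)
  qed
  then have "(\<Sum>(p, q)\<in>splits m. mfps_nth ?X p * mfps_nth f q)
      = (\<Sum>(p, q)\<in>{(0(v := 1), m(v := m v - 1))}. mfps_nth ?X p * mfps_nth f q)"
    using split by (intro sum.mono_neutral_right finite_splits) (auto simp: splits_def)
  with False show ?thesis by (simp add: times_mfps.rep_eq mfps_nth_var)
qed

lemma mfps_var_mult_eq_0: "mfps_var v * f = 0 \<Longrightarrow> f = 0"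
proof (rule mfps_eqI)
  fix m
  assume "mfps_var v * f = 0"
  \<comment> \<open>The coefficient of \<open>f\<close> at \<open>m\<close> reappears in the product
    at the exponent raised by one in \<open>v\<close>.\<close>
  then have "mfps_nth (mfps_var v * f) (m(v := Suc (m v))) = mfps_nth 0 (m(v := Suc (m v)))"
    by simp
  then show "mfps_nth f m = mfps_nth 0 m"
    by (simp add: mfps_nth_var_mult zero_mfps.rep_eq)
qed

lemma one_plus_mfps_var_mult_neq_0:
  fixes f :: "('a::comm_ring_1, 'n::finite) mfps"
  shows "1 + mfps_var v * f \<noteq> 0"
proof
  assume "1 + mfps_var v * f = 0"
  then have "mfps_nth (1 + mfps_var v * f) 0 = mfps_nth (0 :: ('a, 'n) mfps) 0"
    by simp
  then show False
    by (simp add: plus_mfps.rep_eq one_mfps.rep_eq zero_mfps.rep_eq mfps_nth_var_mult)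
qed

lemma mfps_geometric_sum:
  fixes b :: "nat \<Rightarrow> ('a::comm_ring_1, 'n::finite) mfps"
  shows "\<exists>s. \<forall>n. s n = b n + mfps_var v * s (Suc n)"
proof -
  \<comment> \<open>This is the coefficient at \<open>m\<close> of the sum of
    \<open>X^i * b (n + i)\<close> over all \<open>i\<close>, with \<open>X\<close> the variable
    \<open>v\<close>; terms with \<open>i > m v\<close> contribute nothing.\<close>
  define s where "s n = Abs_mfps (\<lambda>m. \<Sum>i\<le>m v. mfps_nth (b (n + i)) (m(v := m v - i)))" for n
  have nth_s: "mfps_nth (s n) m = (\<Sum>i\<le>m v. mfps_nth (b (n + i)) (m(v := m v - i)))" for n m
    by (simp add: s_def Abs_mfps_inverse)
  have "s n = b n + mfps_var v * s (Suc n)" for n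
  proof (rule mfps_eqI)
    fix m
    show "mfps_nth (s n) m = mfps_nth (b n + mfps_var v * s (Suc n)) m"
    proof (cases "m v")
      case 0
      then have "m(v := 0) = m" by auto
      with 0 show ?thesis by (simp add: nth_s plus_mfps.rep_eq mfps_nth_var_mult)
    next
      \<comment> \<open>The term \<open>i = 0\<close> gives the coefficient of \<open>b n\<close>;
        the others, reindexed by one, form that of \<open>s (Suc n)\<close> at
        \<open>m(v := k)\<close>.\<close>
      case (Suc k)
      then have "m(v := Suc k) = m" by auto
      with Suc show ?thesis
        by (simp add: nth_s plus_mfps.rep_eq mfps_nth_var_mult sum.atMost_Suc_shift
            del: sum.atMost_Suc)
    qed
  qed
  then show ?thesis by blast
qed

section \<open>Bases over the smaller power series ring\<close>

context field_extension
begin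

lemma vector_space: "vector_space (\<lambda>a x. \<iota> a * x)"
  by standard (simp_all add: hom_add hom_mult hom_one algebra_simps)

lemma mfps_map_var: "mfps_map \<iota> (mfps_var v) = mfps_var v"
  by (rule mfps_eqI) (simp add: mfps_nth_var hom_zero hom_one)

lemma finite_module_basis:
  fixes B :: "('k, 'n::finite) mfps set"
  assumes "module_basis (mfps_scale \<iota> :: ('f, 'n) mfps \<Rightarrow> _) B"
  shows "finite B"
proof -
  interpret S: module "mfps_scale \<iota> :: ('f, 'n) mfps \<Rightarrow> ('k, 'n) mfps \<Rightarrow> _"
    by (rule module_mfps_scale)
  show ?thesis
  proof (rule S.finite_basis_if_geometric_sums)
    show "S.independent B" "S.span B = UNIV"
      using assms by (auto simp: module_basis_def)
    fix b :: "nat \<Rightarrow> ('k, 'n) mfps"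
    \<comment> \<open>Any variable serves; \<open>undefined\<close> names one, since the index type
      is nonempty.\<close>
    show "\<exists>s. \<forall>n. s n = b n + mfps_scale \<iota> (mfps_var undefined) (s (Suc n))"
      unfolding mfps_scale_def mfps_map_var by (rule mfps_geometric_sum)
  qed (fact mfps_var_mult_eq_0 one_plus_mfps_var_mult_neq_0)+
qed

lemma finite_extension_if_finite_module_basis:
  fixes B :: "('k, 'n::finite) mfps set"
  assumes "finite B" and "module_basis (mfps_scale \<iota> :: ('f, 'n) mfps \<Rightarrow> _) B"
  shows "finite_extension \<iota>"
proof -
  interpret S: module "mfps_scale \<iota> :: ('f, 'n) mfps \<Rightarrow> ('k, 'n) mfps \<Rightarrow> _"
    by (rule module_mfps_scale)
  interpret K: vector_space "\<lambda>a x. \<iota> a * x"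
    by (rule vector_space)
  let ?C = "(\<lambda>b. mfps_nth b 0) ` B"
  have "x \<in> K.span ?C" for x
  proof -
    have "mfps_const x \<in> S.span B"
      using assms(2) by (simp add: module_basis_def)
    then obtain r where "mfps_const x = (\<Sum>b\<in>B. mfps_scale \<iota> (r b) b)"
      unfolding S.span_finite[OF assms(1)] by blast
    then have "mfps_nth (mfps_const x :: ('k, 'n) mfps) 0 = mfps_nth (\<Sum>b\<in>B. mfps_scale \<iota> (r b) b) 0"
      by simp
    then have "x = (\<Sum>b\<in>B. \<iota> (mfps_nth (r b) 0) * mfps_nth b 0)"
      by (simp add: mfps_nth_const mfps_nth_sum mfps_scale_def mfps_nth_mult_zero)
    also have "\<dots> \<in> K.span ?C"
      by (intro K.span_sum K.span_scale K.span_base) simp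
    finally show ?thesis .
  qed
  then have span: "K.span ?C = UNIV" by blast
  \<comment> \<open>The constant terms span but may be dependent, so they are thinned out to a
    basis.\<close>
  obtain E where E: "E \<subseteq> ?C" "K.independent E" "?C \<subseteq> K.span E"
    using K.maximal_independent_subset by blast
  have "K.span E = UNIV"
    using K.span_mono[OF E(3)] span by (simp add: K.span_span top.extremum_unique)
  moreover have "finite E"
    using E(1) assms(1) finite_subset by blast
  ultimately have "finite_dimensional_vector_space (\<lambda>a x. \<iota> a * x) E"
    using E(2) by unfold_locales
  then show ?thesis unfolding finite_extension_def by blast
qed

lemma module_basis_mfps_const:
  assumes "finite_dimensional_vector_space (\<lambda>a x. \<iota> a * x) E"
  shows "module_basis (mfps_scale \<iota> :: ('f, 'n::finite) mfps \<Rightarrow> ('k, 'n) mfps \<Rightarrow> _) (mfps_const ` E)"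
proof -
  interpret K: finite_dimensional_vector_space "\<lambda>a x. \<iota> a * x" E
    by (rule assms)
  interpret S: module "mfps_scale \<iota> :: ('f, 'n) mfps \<Rightarrow> ('k, 'n) mfps \<Rightarrow> _"
    by (rule module_mfps_scale)
  let ?c = "mfps_const :: 'k \<Rightarrow> ('k, 'n) mfps"
  have fin: "finite (?c ` E)"
    using K.finite_Basis by simp
  \<comment> \<open>At each exponent a combination of the constant series is a combination of
    \<open>E\<close> over the smaller field, so independence and spanning both reduce to those of
    \<open>E\<close>.\<close>
  have nth_comb: "mfps_nth (\<Sum>v\<in>?c ` E. mfps_scale \<iota> (u v) v) m
      = (\<Sum>e\<in>E. \<iota> (mfps_nth (u (?c e)) m) * e)" for u m
    by (simp add: sum.reindex inj_on_subset[OF inj_mfps_const] mfps_nth_sum mfps_scale_def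
        mfps_nth_mult_const)
  have "u (?c e) = 0"
    if "(\<Sum>v\<in>?c ` E. mfps_scale \<iota> (u v) v) = 0" and "e \<in> E" for u e
  proof (rule mfps_eqI)
    fix m
    have "(\<Sum>e\<in>E. \<iota> (mfps_nth (u (?c e)) m) * e) = 0"
      using nth_comb[of u m] that(1) by (simp add: zero_mfps.rep_eq)
    then show "mfps_nth (u (?c e)) m = mfps_nth 0 m"
      using K.independentD[OF K.independent_Basis K.finite_Basis subset_refl] that(2)
      by (simp add: zero_mfps.rep_eq)
  qed
  then have indep: "S.independent (?c ` E)"
    unfolding S.dependent_finite[OF fin] by blast
  have "f \<in> S.span (?c ` E)" for f
  proof -
    \<comment> \<open>For \<open>v = mfps_const e\<close> the constant term recovers
      \<open>e\<close>, so the coefficient of \<open>u v\<close> at \<open>m\<close> is the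
      coordinate at \<open>e\<close> of the coefficient of \<open>f\<close> at
      \<open>m\<close>.\<close>
    define u :: "('k, 'n) mfps \<Rightarrow> ('f, 'n) mfps" where
      "u v = Abs_mfps (\<lambda>m. K.representation E (mfps_nth f m) (mfps_nth v 0))" for v
    have "f = (\<Sum>v\<in>?c ` E. mfps_scale \<iota> (u v) v)"
    proof (rule mfps_eqI)
      fix m
      have "(\<Sum>e\<in>E. \<iota> (K.representation E (mfps_nth f m) e) * e) = mfps_nth f m"
        by (rule K.sum_representation_eq)
           (simp_all add: K.independent_Basis K.finite_Basis K.span_Basis)
      then show "mfps_nth f m = mfps_nth (\<Sum>v\<in>?c ` E. mfps_scale \<iota> (u v) v) m"
        by (simp add: nth_comb u_def Abs_mfps_inverse mfps_nth_const)
    qed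
    then show ?thesis unfolding S.span_finite[OF fin] by blast
  qed
  with indep show ?thesis unfolding module_basis_def by blast
qed

end

theorem theorem1p2:
  fixes \<iota> :: "'f::field \<Rightarrow> 'k::field"
  assumes "field_extension \<iota>"
  shows "(free_module
            (mfps_scale \<iota> :: ('f, 'n::finite) mfps \<Rightarrow> ('k, 'n) mfps \<Rightarrow> ('k, 'n) mfps)
          \<longrightarrow> free_module_of_finite_rank
            (mfps_scale \<iota> :: ('f, 'n) mfps \<Rightarrow> ('k, 'n) mfps \<Rightarrow> ('k, 'n) mfps))
       \<and> (free_module
            (mfps_scale \<iota> :: ('f, 'n) mfps \<Rightarrow> ('k, 'n) mfps \<Rightarrow> ('k, 'n) mfps)
          \<longleftrightarrow> finite_extension \<iota>)"
proof -
  interpret field_extension \<iota> by (rule assms)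
  show ?thesis
    unfolding free_module_def free_module_of_finite_rank_def
    using finite_module_basis finite_extension_if_finite_module_basis module_basis_mfps_const
    unfolding finite_extension_def by blast
qed

end
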